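(* Let $(X,\rho)$ and $(Y,\sigma)$ be topologically complete metric spaces. Let $A\subseteq X$ be a Suslin set in $X$ and $B\subseteq Y$ a Suslin set in $Y$. If $A$ is not $\sigma$-lower porous in $X$ and $B$ is not $\sigma$-porous in $Y$, then the Cartesian product $A\times B$ is not $\sigma$-lower porous in $X\times Y$ equipped with the maximum metric.
   Context: A metric space is topologically complete if its topology is induced by some complete metric. A Suslin set is a set obtained by the Suslin operation from closed sets. Let $(X,\rho)$ be a metric space; $B(x,r)$ denotes the open ball with centre $x$ and radius $r$. For $M\subseteq X$, $x\in X$, $R>0$ put $$\gamma(x,R,M)=\sup\{r>0:\ \text{for some } z\in X,\ B(z,r)\subseteq B(x,R)\setminus M\}$$ (with $\sup\emptyset=0$), and $$\overline{p}(M,x)=\limsup_{R\to0_+}\frac{2\gamma(x,R,M)}{R},\qquad \underline{p}(M,x)=\liminf_{R\to0_+}\frac{2\gamma(x,R,M)}{R}.$$ The set $M$ is (upper) porous at $x$ if $\overline{p}(M,x)>0$ and lower porous at $x$ if $\underline{p}(M,x)>0$; $M$ is porous (resp. lower porous) in $X$ if it is so at each of its points; $M$ is $\sigma$-porous (resp. $\sigma$-lower porous) in $X$ if it is a countable union of porous (resp. lower porous) sets. The maximum metric on $X\times Y$ is $\rho_m([x_1;y_1],[x_2;y_2])=\max\{\rho(x_1,x_2),\sigma(y_1,y_2)\}$, where $[x;y]$ denotes an ordered pair. *)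

theory Defs
  imports "HOL-Analysis.Analysis"
begin

text \<open>Sets obtained by the Suslin operation from a scheme of closed sets, indexed by the
  nonempty finite sequences of natural numbers.\<close>

definition suslin_in :: "'a topology \<Rightarrow> 'a set \<Rightarrow> bool" where
  "suslin_in T S \<longleftrightarrow>
     (\<exists>F :: nat list \<Rightarrow> 'a set.
        (\<forall>s. closedin T (F s)) \<and>
        S = (\<Union>f :: nat \<Rightarrow> nat. \<Inter>n. F (map f [0..<Suc n])))"

context Metric_space
begin

text \<open>The supremum may be infinite (a bounded space can equal all its large balls), so values
  lie in \<^typ>\<open>ennreal\<close>, where moreover the supremum of the empty set is 0.\<close>

definition hole_size :: "'a \<Rightarrow> real \<Rightarrow> 'a set \<Rightarrow> ennreal" where
  "hole_size x R A =
     (SUP r \<in> {r :: real. r > 0 \<and> (\<exists>z\<in>M. mball z r \<subseteq> mball x R - A)}. ennreal r)"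

definition upper_porosity :: "'a set \<Rightarrow> 'a \<Rightarrow> ennreal" where
  "upper_porosity A x = Limsup (at_right 0) (\<lambda>R. 2 * hole_size x R A / ennreal R)"

definition lower_porosity :: "'a set \<Rightarrow> 'a \<Rightarrow> ennreal" where
  "lower_porosity A x = Liminf (at_right 0) (\<lambda>R. 2 * hole_size x R A / ennreal R)"

definition porous_at :: "'a set \<Rightarrow> 'a \<Rightarrow> bool" where
  "porous_at A x \<longleftrightarrow> upper_porosity A x > 0"

definition lower_porous_at :: "'a set \<Rightarrow> 'a \<Rightarrow> bool" where
  "lower_porous_at A x \<longleftrightarrow> lower_porosity A x > 0"

definition porous :: "'a set \<Rightarrow> bool" where
  "porous A \<longleftrightarrow> A \<subseteq> M \<and> (\<forall>x\<in>A. porous_at A x)"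

definition lower_porous :: "'a set \<Rightarrow> bool" where
  "lower_porous A \<longleftrightarrow> A \<subseteq> M \<and> (\<forall>x\<in>A. lower_porous_at A x)"

definition sigma_porous :: "'a set \<Rightarrow> bool" where
  "sigma_porous A \<longleftrightarrow> (\<exists>N :: nat \<Rightarrow> 'a set. (\<forall>n. porous (N n)) \<and> A = (\<Union>n. N n))"

definition sigma_lower_porous :: "'a set \<Rightarrow> bool" where
  "sigma_lower_porous A \<longleftrightarrow> (\<exists>N :: nat \<Rightarrow> 'a set. (\<forall>n. lower_porous (N n)) \<and> A = (\<Union>n. N n))"

end

definition max_dist ::
    "('a \<Rightarrow> 'a \<Rightarrow> real) \<Rightarrow> ('b \<Rightarrow> 'b \<Rightarrow> real) \<Rightarrow> 'a \<times> 'b \<Rightarrow> 'a \<times> 'b \<Rightarrow> real" where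
  "max_dist d1 d2 p q = max (d1 (fst p) (fst q)) (d2 (snd p) (snd q))"

lemma Metric_space_max_dist:
  assumes "Metric_space X d1" and "Metric_space Y d2"
  shows "Metric_space (X \<times> Y) (max_dist d1 d2)"
proof -
  interpret A: Metric_space X d1 by fact
  interpret B: Metric_space Y d2 by fact
  show ?thesis
  proof
    fix p q
    show "0 \<le> max_dist d1 d2 p q"
      by (simp add: max_dist_def le_max_iff_disj)
    show "max_dist d1 d2 p q = max_dist d1 d2 q p"
      by (simp add: max_dist_def A.commute B.commute)
  next
    fix p q assume pq: "p \<in> X \<times> Y" "q \<in> X \<times> Y"
    have "max_dist d1 d2 p q = 0 \<longleftrightarrow> d1 (fst p) (fst q) = 0 \<and> d2 (snd p) (snd q) = 0"
      using A.nonneg[of "fst p" "fst q"] B.nonneg[of "snd p" "snd q"]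
      unfolding max_dist_def by linarith
    also have "\<dots> \<longleftrightarrow> p = q"
      using pq A.zero[of "fst p" "fst q"] B.zero[of "snd p" "snd q"]
      by (simp add: mem_Times_iff prod_eq_iff)
    finally show "max_dist d1 d2 p q = 0 \<longleftrightarrow> p = q" .
  next
    fix p q r assume "p \<in> X \<times> Y" "q \<in> X \<times> Y" "r \<in> X \<times> Y"
    then have "d1 (fst p) (fst r) \<le> d1 (fst p) (fst q) + d1 (fst q) (fst r)"
      and "d2 (snd p) (snd r) \<le> d2 (snd p) (snd q) + d2 (snd q) (snd r)"
      by (auto intro: A.triangle B.triangle)
    then show "max_dist d1 d2 p r \<le> max_dist d1 d2 p q + max_dist d1 d2 q r"
      unfolding max_dist_def by linarith
  qed
qed

end

theory Submission
  imports Defs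
begin

text \<open>Suppose \<open>A \<times> B\<close> is covered by sets \<open>P n\<close>, each uniformly lower porous. Both families of small
  sets are \<open>\<sigma>\<close>-ideals of a local nature, so every non-small set contains a kernel none of whose
  nonempty portions is small. If \<open>K\<close> and \<open>L\<close> are kernels of non-small subsets of \<open>A\<close> and \<open>B\<close>, then
  \<open>K \<times> L\<close> is not contained in the closure of \<open>P n\<close>: take \<open>x \<in> K\<close> at which \<open>K\<close> is not lower porous
  and \<open>y \<in> L\<close> at which \<open>L\<close> is not porous; a hole of \<open>P n\<close> near \<open>(x, y)\<close> would project to a hole
  of \<open>K\<close> or of \<open>L\<close> of the same size. Hence one can shrink \<open>K\<close> and \<open>L\<close> to non-small portions of small diameter
  whose closures avoid \<open>P n\<close>. Iterating this, while descending along branches of the two Suslin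
  schemes and using completeness, yields a point of \<open>A \<times> B\<close> outside all \<open>P n\<close>.\<close>

section \<open>Local \<open>\<sigma>\<close>-ideals of small sets\<close>

text \<open>Porosity and lower porosity at a point both depend only on the set near that point and
  pass to subsets. The one assumption captures both facts, so the kernel argument is done once for
  the two ideals.\<close>

locale pointwise_smallness = Metric_space +
  fixes small_at :: "'a set \<Rightarrow> 'a \<Rightarrow> bool"
  assumes small_at_mono: "\<lbrakk>0 < e; B \<inter> mball x e \<subseteq> A; small_at A x\<rbrakk> \<Longrightarrow> small_at B x"
begin

definition small :: "'a set \<Rightarrow> bool" where
  "small A \<longleftrightarrow> A \<subseteq> M \<and> (\<forall>x\<in>A. small_at A x)"

definition sigma_small :: "'a set \<Rightarrow> bool" where
  "sigma_small A \<longleftrightarrow> (\<exists>N :: nat \<Rightarrow> 'a set. (\<forall>n. small (N n)) \<and> A = (\<Union>n. N n))"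

lemma small_subset: "\<lbrakk>small A; B \<subseteq> A\<rbrakk> \<Longrightarrow> small B"
  unfolding small_def using small_at_mono[OF zero_less_one, of B _ A] by blast

lemma sigma_small_subset:
  assumes "sigma_small A" "B \<subseteq> A"
  shows "sigma_small B"
proof -
  obtain N :: "nat \<Rightarrow> 'a set" where N: "\<And>n. small (N n)" "A = (\<Union>n. N n)"
    using assms(1) unfolding sigma_small_def by auto
  have "small (N n \<inter> B)" for n
    using N(1) small_subset by blast
  moreover have "B = (\<Union>n. N n \<inter> B)"
    using N(2) assms(2) by blast
  ultimately show ?thesis
    unfolding sigma_small_def by (intro exI[of _ "\<lambda>n. N n \<inter> B"]) simp
qed

lemma sigma_small_UN:
  fixes A :: "nat \<Rightarrow> 'a set"
  assumes "\<And>n. sigma_small (A n)"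
  shows "sigma_small (\<Union>n. A n)"
proof -
  obtain N :: "nat \<Rightarrow> nat \<Rightarrow> 'a set"
    where N: "\<And>n k. small (N n k)" "\<And>n. A n = (\<Union>k. N n k)"
    using assms unfolding sigma_small_def by metis
  have "(\<Union>n. A n) = (\<Union>i. case prod_decode i of (n, k) \<Rightarrow> N n k)"
  proof (intro equalityI subsetI)
    fix x assume "x \<in> (\<Union>n. A n)"
    then obtain n k where "x \<in> N n k" using N(2) by blast
    then show "x \<in> (\<Union>i. case prod_decode i of (n, k) \<Rightarrow> N n k)"
      by (intro UN_I[of "prod_encode (n, k)"]) auto
  next
    fix x assume "x \<in> (\<Union>i. case prod_decode i of (n, k) \<Rightarrow> N n k)"
    then obtain i where "x \<in> (case prod_decode i of (n, k) \<Rightarrow> N n k)" by (rule UN_E)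
    then show "x \<in> (\<Union>n. A n)" by (cases "prod_decode i") (auto simp: N(2))
  qed
  moreover have "small (case prod_decode i of (n, k) \<Rightarrow> N n k)" for i
    by (simp add: N(1) split: prod.splits)
  ultimately show ?thesis
    unfolding sigma_small_def
    by (intro exI[of _ "\<lambda>i. case prod_decode i of (n, k) \<Rightarrow> N n k"]) simp
qed

lemma sigma_small_Un:
  assumes "sigma_small A" "sigma_small B"
  shows "sigma_small (A \<union> B)"
proof -
  have "A \<union> B = (\<Union>n::nat. if n = 0 then A else B)" by auto
  also have "sigma_small \<dots>" using assms by (intro sigma_small_UN) auto
  finally show ?thesis .
qed

text \<open>As in A. H. Stone's theorem, the points are grouped by the first member, in a well-ordering
  of the cover, that contains them; the points of different groups lying deep inside their
  respective members are uniformly separated.\<close>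

lemma sigma_small_local:
  assumes "A \<subseteq> M"
    and loc: "\<And>x. x \<in> A \<Longrightarrow> \<exists>U. openin mtopology U \<and> x \<in> U \<and> sigma_small (A \<inter> U)"
  shows "sigma_small A"
proof -
  obtain U where U: "\<And>x. x \<in> A \<Longrightarrow> openin mtopology (U x)" "\<And>x. x \<in> A \<Longrightarrow> x \<in> U x"
    "\<And>x. x \<in> A \<Longrightarrow> sigma_small (A \<inter> U x)"
    using loc by metis
  obtain N :: "'a \<Rightarrow> nat \<Rightarrow> 'a set"
    where N: "\<And>a k. a \<in> A \<Longrightarrow> small (N a k)" "\<And>a. a \<in> A \<Longrightarrow> A \<inter> U a = (\<Union>k. N a k)"
    using U(3) unfolding sigma_small_def by metis
  obtain r :: "'a rel" where r: "Well_order r" "Field r = UNIV"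
    by (rule exE[OF well_ordering[where 'a='a]]) (erule conjE)
  have wf: "wf (r - Id)"
    using r(1) by (simp add: well_order_on_def)
  have "total r"
    using r by (simp add: well_order_on_def linear_order_on_def)
  then have tot: "(a, b) \<in> r - Id \<or> (b, a) \<in> r - Id" if "a \<noteq> b" for a b
    using that by (simp add: total_on_def)
  have "\<exists>a. a \<in> A \<and> x \<in> U a \<and> (\<forall>b. (b, a) \<in> r - Id \<longrightarrow> \<not> (b \<in> A \<and> x \<in> U b))" if "x \<in> A" for x
  proof -
    have "x \<in> {a \<in> A. x \<in> U a}" using U(2) that by simp
    from wf[unfolded wf_eq_minimal, rule_format, OF this] show ?thesis
      unfolding Bex_def mem_Collect_eq by (simp only: conj_assoc)
  qed
  then obtain m where m: "\<And>x. x \<in> A \<Longrightarrow> m x \<in> A" "\<And>x. x \<in> A \<Longrightarrow> x \<in> U (m x)"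
    "\<And>x b. \<lbrakk>x \<in> A; (b, m x) \<in> r - Id; b \<in> A\<rbrakk> \<Longrightarrow> x \<notin> U b"
    by metis
  \<comment> \<open>\<open>n\<close> fixes how deep \<open>x\<close> lies in its own member,
    \<open>k\<close> the small piece of that member it falls in.\<close>
  define Q where "Q n k = {x \<in> A. mball x (inverse (Suc n)) \<subseteq> U (m x) \<and> x \<in> N (m x) k}" for n k
  have "small (Q n k)" for n k
    unfolding small_def
  proof (intro conjI ballI)
    show "Q n k \<subseteq> M" using assms(1) by (auto simp: Q_def)
    fix x assume x: "x \<in> Q n k"
    \<comment> \<open>Points of \<open>Q n k\<close> closer than \<open>inverse (Suc n)\<close> lie
      in each other's members; minimality on both sides makes their indices equal, so near
      \<open>x\<close> only one piece occurs.\<close>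
    have "Q n k \<inter> mball x (inverse (Suc n)) \<subseteq> N (m x) k"
    proof
      fix y assume y: "y \<in> Q n k \<inter> mball x (inverse (Suc n))"
      then have "x \<in> mball y (inverse (Suc n))" by (simp add: commute)
      then have "x \<in> U (m y)" "y \<in> U (m x)"
        using x y unfolding Q_def by blast+
      moreover have "x \<in> A" "y \<in> A" using x y by (auto simp: Q_def)
      ultimately have "m x = m y"
        using tot[of "m x" "m y"] m by blast
      then show "y \<in> N (m x) k" using y by (auto simp: Q_def)
    qed
    moreover have "small_at (N (m x) k) x"
      using x N(1)[OF m(1)] unfolding Q_def small_def by blast
    ultimately show "small_at (Q n k) x"
      using small_at_mono[of "inverse (Suc n)"] by simp
  qed
  then have "sigma_small (\<Union>k. Q n k)" for n
    unfolding sigma_small_def by blast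
  then have "sigma_small (\<Union>n. \<Union>k. Q n k)"
    by (rule sigma_small_UN)
  moreover have "A \<subseteq> (\<Union>n. \<Union>k. Q n k)"
  proof
    fix x assume x: "x \<in> A"
    obtain e where "e > 0" "mball x e \<subseteq> U (m x)"
      using U(1) m(1,2) x unfolding openin_mtopology by meson
    moreover obtain n where "inverse (Suc n) < e"
      using reals_Archimedean \<open>e > 0\<close> by blast
    ultimately have "mball x (inverse (Suc n)) \<subseteq> U (m x)"
      using mball_subset_concentric[of "inverse (Suc n)" e x] by fastforce
    moreover obtain k where "x \<in> N (m x) k"
      using N(2)[OF m(1)[OF x]] m(2)[OF x] x by blast
    ultimately show "x \<in> (\<Union>n. \<Union>k. Q n k)" using x by (auto simp: Q_def)
  qed
  ultimately show ?thesis by (rule sigma_small_subset)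
qed

text \<open>Discard the points near which \<open>A\<close> is \<sigma>-small. By
  \<open>sigma_small_local\<close> the discarded part is \<sigma>-small, so adding it to a
  \<sigma>-small portion of \<open>K\<close> would make \<open>A\<close> \<sigma>-small near a point
  of \<open>K\<close>.\<close>

lemma non_sigma_small_kernel:
  assumes "A \<subseteq> M" "\<not> sigma_small A"
  obtains K where "K \<subseteq> A" "K \<noteq> {}"
    "\<And>U. \<lbrakk>openin mtopology U; K \<inter> U \<noteq> {}\<rbrakk> \<Longrightarrow> \<not> sigma_small (K \<inter> U)"
proof -
  define K where "K = {x \<in> A. \<forall>U. openin mtopology U \<longrightarrow> x \<in> U \<longrightarrow> \<not> sigma_small (A \<inter> U)}"
  have diff: "sigma_small (A - K)"
  proof (rule sigma_small_local)
    fix x assume "x \<in> A - K"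
    then obtain U where "openin mtopology U" "x \<in> U" "sigma_small (A \<inter> U)"
      by (auto simp: K_def)
    moreover have "(A - K) \<inter> U \<subseteq> A \<inter> U" by blast
    ultimately show "\<exists>U. openin mtopology U \<and> x \<in> U \<and> sigma_small ((A - K) \<inter> U)"
      using sigma_small_subset by blast
  qed (use assms(1) in blast)
  show ?thesis
  proof
    show "K \<subseteq> A" by (auto simp: K_def)
    show "K \<noteq> {}" using diff assms(2) by force
    fix U assume U: "openin mtopology U" "K \<inter> U \<noteq> {}"
    show "\<not> sigma_small (K \<inter> U)"
    proof
      assume "sigma_small (K \<inter> U)"
      then have "sigma_small ((A - K) \<union> (K \<inter> U))" using diff by (rule sigma_small_Un[rotated])
      moreover have "A \<inter> U \<subseteq> (A - K) \<union> (K \<inter> U)" by blast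
      ultimately have "sigma_small (A \<inter> U)" by (rule sigma_small_subset)
      then show False using U by (auto simp: K_def)
    qed
  qed
qed

end

section \<open>Porosity\<close>

context Metric_space
begin

lemma hole_size_mono: "B \<inter> mball x R \<subseteq> A \<Longrightarrow> hole_size x R A \<le> hole_size x R B"
  unfolding hole_size_def by (rule SUP_subset_mono) blast+

text \<open>Once \<open>R < e\<close>, the hole size sees only what lies inside
  \<open>mball x e\<close>. This gives locality for the limsup and the liminf alike.\<close>

lemma eventually_hole_ratio_mono:
  assumes "0 < e" "B \<inter> mball x e \<subseteq> A"
  shows "\<forall>\<^sub>F R in at_right 0.
    2 * hole_size x R A / ennreal R \<le> 2 * hole_size x R B / ennreal R"
proof -
  have "\<forall>\<^sub>F R in at_right (0::real). R < e"
    using assms(1) by (auto simp: eventually_at_right)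
  then show ?thesis
  proof eventually_elim
    case (elim R)
    then have "B \<inter> mball x R \<subseteq> A"
      using assms(2) mball_subset_concentric[of R e x] by auto
    then show ?case
      by (intro divide_right_mono_ennreal mult_left_mono hole_size_mono) auto
  qed
qed

sublocale porous: pointwise_smallness M d porous_at
  rewrites "porous.small = porous" and "porous.sigma_small = sigma_porous"
proof -
  show *: "pointwise_smallness M d porous_at"
  proof
    fix e :: real and A B x
    assume "0 < e" "B \<inter> mball x e \<subseteq> A" "porous_at A x"
    then show "porous_at B x"
      unfolding porous_at_def upper_porosity_def
      using Limsup_mono[OF eventually_hole_ratio_mono] order_less_le_trans by blast
  qed
  show 1: "pointwise_smallness.small M porous_at = porous"
    unfolding pointwise_smallness.small_def[OF *] porous_def fun_eq_iff by simp
  show "pointwise_smallness.sigma_small M porous_at = sigma_porous"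
    unfolding pointwise_smallness.sigma_small_def[OF *] sigma_porous_def 1 fun_eq_iff by simp
qed

sublocale lower_porous: pointwise_smallness M d lower_porous_at
  rewrites "lower_porous.small = lower_porous" and "lower_porous.sigma_small = sigma_lower_porous"
proof -
  show *: "pointwise_smallness M d lower_porous_at"
  proof
    fix e :: real and A B x
    assume "0 < e" "B \<inter> mball x e \<subseteq> A" "lower_porous_at A x"
    then show "lower_porous_at B x"
      unfolding lower_porous_at_def lower_porosity_def
      using Liminf_mono[OF eventually_hole_ratio_mono] order_less_le_trans by blast
  qed
  show 1: "pointwise_smallness.small M lower_porous_at = lower_porous"
    unfolding pointwise_smallness.small_def[OF *] lower_porous_def fun_eq_iff by simp
  show "pointwise_smallness.sigma_small M lower_porous_at = sigma_lower_porous"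
    unfolding pointwise_smallness.sigma_small_def[OF *] sigma_lower_porous_def 1 fun_eq_iff by simp
qed

section \<open>Porosity ratios and concrete holes\<close>

lemma hole_ratio_ge:
  assumes "0 < c" "0 < R" "z \<in> M" "c * R < r" "mball z r \<subseteq> mball x R - A"
  shows "ennreal (2 * c) \<le> 2 * hole_size x R A / ennreal R"
proof -
  have "0 < r" using assms by (smt (verit) mult_pos_pos)
  then have "ennreal r \<le> hole_size x R A"
    unfolding hole_size_def using assms by (intro SUP_upper) blast
  have "2 * c \<le> 2 * r / R"
    using assms by (simp add: field_simps)
  then have "ennreal (2 * c) \<le> ennreal (2 * r / R)"
    by (rule ennreal_leI)
  also have "\<dots> = 2 * ennreal r / ennreal R"
    using \<open>0 < r\<close> \<open>0 < R\<close> by (simp add: divide_ennreal[symmetric] ennreal_mult')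
  also have "\<dots> \<le> 2 * hole_size x R A / ennreal R"
    using \<open>ennreal r \<le> hole_size x R A\<close> by (intro divide_right_mono_ennreal mult_left_mono) auto
  finally show ?thesis .
qed

text \<open>If every hole had radius at most \<open>c * R\<close>, so would the supremum; strictness
  is what passes from a supremum to an actual ball.\<close>

lemma hole_if_hole_ratio_gt:
  assumes "0 < c" "0 < R" "ennreal (2 * c) < 2 * hole_size x R A / ennreal R"
  shows "\<exists>z\<in>M. \<exists>r > c * R. mball z r \<subseteq> mball x R - A"
proof (rule ccontr)
  assume "\<not> ?thesis"
  then have "hole_size x R A \<le> ennreal (c * R)"
    unfolding hole_size_def by (intro SUP_least ennreal_leI) (auto simp: not_less[symmetric])
  then have "2 * hole_size x R A / ennreal R \<le> 2 * ennreal (c * R) / ennreal R"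
    by (intro divide_right_mono_ennreal mult_left_mono) auto
  also have "\<dots> = ennreal (2 * (c * R) / R)"
    using assms by (subst divide_ennreal[symmetric]) (simp_all add: ennreal_mult')
  also have "\<dots> = ennreal (2 * c)"
    using assms by simp
  finally show False using assms(3) by simp
qed

text \<open>A zero limsup excludes relatively large holes at every small scale, a zero liminf (next
  lemma) only at some arbitrarily small ones. The product argument combines the two.\<close>

lemma not_porous_at_eventually_no_hole:
  assumes "\<not> porous_at A x" "0 < c"
  shows "\<forall>\<^sub>F R in at_right 0. \<not> (\<exists>z\<in>M. \<exists>r > c * R. mball z r \<subseteq> mball x R - A)"
proof -
  have "upper_porosity A x < ennreal (2 * c)"
    using assms by (simp add: porous_at_def)
  then have "\<forall>\<^sub>F R in at_right 0. 2 * hole_size x R A / ennreal R < ennreal (2 * c)"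
    unfolding upper_porosity_def by (rule Limsup_lessD)
  moreover have "\<forall>\<^sub>F R in at_right (0::real). 0 < R"
    by (rule eventually_at_right_less)
  ultimately show ?thesis
    by eventually_elim (use hole_ratio_ge[OF assms(2)] in \<open>meson not_le\<close>)
qed

lemma not_lower_porous_at_frequently_no_hole:
  assumes "\<not> lower_porous_at A x" "0 < c"
  shows "\<exists>\<^sub>F R in at_right 0. \<not> (\<exists>z\<in>M. \<exists>r > c * R. mball z r \<subseteq> mball x R - A)"
proof (rule ccontr)
  assume "\<not> ?thesis"
  then have "\<forall>\<^sub>F R in at_right 0. \<exists>z\<in>M. \<exists>r > c * R. mball z r \<subseteq> mball x R - A"
    by (simp add: not_frequently)
  moreover have "\<forall>\<^sub>F R in at_right (0::real). 0 < R"
    by (rule eventually_at_right_less)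
  ultimately have "\<forall>\<^sub>F R in at_right 0. ennreal (2 * c) \<le> 2 * hole_size x R A / ennreal R"
    by eventually_elim (use hole_ratio_ge[OF assms(2)] in blast)
  then have "ennreal (2 * c) \<le> lower_porosity A x"
    unfolding lower_porosity_def by (rule Liminf_bounded)
  then show False using assms by (simp add: lower_porous_at_def)
qed

text \<open>One constant bounds both the scales and the relative size of the holes, for all points
  of the set. Holes are thus available at any point of \<open>A\<close> near a given one, at a scale
  fixed beforehand.\<close>

definition uniformly_holed :: "real \<Rightarrow> 'a set \<Rightarrow> bool" where
  "uniformly_holed c A \<longleftrightarrow>
    (\<forall>x\<in>A. \<forall>R. 0 < R \<longrightarrow> R < c \<longrightarrow> (\<exists>z\<in>M. \<exists>r > c * R. mball z r \<subseteq> mball x R - A))"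

lemma lower_porous_at_hole:
  assumes "lower_porous_at A x"
  obtains c where "0 < c"
    "\<And>R. \<lbrakk>0 < R; R < c\<rbrakk> \<Longrightarrow> \<exists>z\<in>M. \<exists>r > c * R. mball z r \<subseteq> mball x R - A"
proof -
  obtain y where y: "0 < y" "y < lower_porosity A x"
    using assms dense unfolding lower_porous_at_def by blast
  then obtain q where q: "y = ennreal q" "q > 0"
    by (metis ennreal_cases ennreal_less_zero_iff infinity_ennreal_def not_less top_greatest)
  have "\<forall>\<^sub>F R in at_right 0. y < 2 * hole_size x R A / ennreal R"
    using y(2) unfolding lower_porosity_def by (rule less_LiminfD)
  then obtain b where b: "0 < b" "\<And>R. \<lbrakk>0 < R; R < b\<rbrakk> \<Longrightarrow> y < 2 * hole_size x R A / ennreal R"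
    unfolding eventually_at_right_field by blast
  show ?thesis
  proof
    \<comment> \<open>Halving \<open>q\<close> absorbs the factor 2 of the ratio; the minimum lets
      one number bound scale and size.\<close>
    show "0 < min (q / 2) b" using q b by simp
    fix R assume R: "0 < R" "R < min (q / 2) b"
    then have "ennreal (2 * (q / 2)) < 2 * hole_size x R A / ennreal R"
      using b(2) q by simp
    then obtain z r where "z \<in> M" "r > q / 2 * R" "mball z r \<subseteq> mball x R - A"
      using hole_if_hole_ratio_gt[of "q / 2" R x A] R q by (meson half_gt_zero)
    moreover have "min (q / 2) b * R \<le> q / 2 * R"
      using R by (intro mult_right_mono) auto
    ultimately show "\<exists>z\<in>M. \<exists>r > min (q / 2) b * R. mball z r \<subseteq> mball x R - A"
      by (meson order.strict_trans1)
  qed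
qed

text \<open>Sort the points of each lower porous set by a constant \<open>inverse (Suc k)\<close>
  that works for them.\<close>

lemma sigma_lower_porous_uniformly_holed:
  assumes "sigma_lower_porous A"
  obtains P :: "nat \<Rightarrow> 'a set" and c :: "nat \<Rightarrow> real"
  where "\<And>n. 0 < c n" "\<And>n. uniformly_holed (c n) (P n)" "\<And>n. P n \<subseteq> M" "A = (\<Union>n. P n)"
proof -
  obtain N :: "nat \<Rightarrow> 'a set" where N: "\<And>n. lower_porous (N n)" "A = (\<Union>n. N n)"
    using assms unfolding sigma_lower_porous_def by blast
  \<comment> \<open>The holes are asked to miss all of \<open>N n\<close>, hence they miss the
    smaller piece too.\<close>
  define P where "P i = (case prod_decode i of (n, k) \<Rightarrow> {x \<in> N n. \<forall>R. 0 < R \<longrightarrow>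
    R < inverse (Suc k) \<longrightarrow> (\<exists>z\<in>M. \<exists>r > inverse (Suc k) * R. mball z r \<subseteq> mball x R - N n)})" for i
  define c where "c i = inverse (real (Suc (snd (prod_decode i))))" for i
  show ?thesis
  proof
    fix i
    show "0 < c i" by (simp add: c_def)
    show "uniformly_holed (c i) (P i)"
      unfolding uniformly_holed_def c_def P_def by (cases "prod_decode i") (simp, blast)
    show "P i \<subseteq> M" using N(1) unfolding P_def lower_porous_def by (auto split: prod.splits)
  next
    show "A = (\<Union>i. P i)"
    proof (intro equalityI subsetI)
      fix x assume "x \<in> A"
      then obtain n where n: "x \<in> N n" using N by blast
      then have "lower_porous_at (N n) x" using N(1) by (simp add: lower_porous_def)
      then obtain b where b: "0 < b"
        "\<And>R. \<lbrakk>0 < R; R < b\<rbrakk> \<Longrightarrow> \<exists>z\<in>M. \<exists>r > b * R. mball z r \<subseteq> mball x R - N n"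
        by (rule lower_porous_at_hole) blast
      obtain k where k: "inverse (Suc k) < b"
        using reals_Archimedean b(1) by blast
      have "\<exists>z\<in>M. \<exists>r > inverse (Suc k) * R. mball z r \<subseteq> mball x R - N n"
        if R: "0 < R" "R < inverse (Suc k)" for R
      proof -
        have "inverse (Suc k) * R < b * R" using R k by simp
        then show ?thesis using b(2)[of R] R k by (meson order.strict_trans)
      qed
      then have "x \<in> P (prod_encode (n, k))" using n by (simp add: P_def)
      then show "x \<in> (\<Union>i. P i)" by blast
    next
      fix x assume "x \<in> (\<Union>i. P i)"
      then obtain i where "x \<in> P i" by blast
      then show "x \<in> A" by (cases "prod_decode i") (auto simp: P_def N(2))
    qed
  qed
qed

end

section \<open>Holes in a product with the maximum metric\<close>

lemma mball_max_dist:
  assumes "Metric_space X \<rho>" "Metric_space Y \<sigma>"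
  shows "Metric_space.mball (X \<times> Y) (max_dist \<rho> \<sigma>) (x, y) r =
    Metric_space.mball X \<rho> x r \<times> Metric_space.mball Y \<sigma> y r"
proof -
  interpret A: Metric_space X \<rho> by fact
  interpret B: Metric_space Y \<sigma> by fact
  interpret P: Metric_space "X \<times> Y" "max_dist \<rho> \<sigma>"
    by (rule Metric_space_max_dist) fact+
  show ?thesis by (auto simp: max_dist_def)
qed

text \<open>Since \<open>D\<close> has no relatively large holes near \<open>y\<close> at \<^emph>\<open>any\<close> small scale, one of the
  scales at which \<open>C\<close> has none near \<open>x\<close> serves both.\<close>

lemma Times_not_uniformly_holed:
  assumes "Metric_space X \<rho>" "Metric_space Y \<sigma>"
    and x: "x \<in> X" "x \<in> C" "\<not> Metric_space.lower_porous_at X \<rho> C x"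
    and y: "y \<in> Y" "y \<in> D" "\<not> Metric_space.porous_at Y \<sigma> D y"
    and c: "0 < c" "Metric_space.uniformly_holed (X \<times> Y) (max_dist \<rho> \<sigma>) c P"
    and PXY: "P \<subseteq> X \<times> Y"
  shows "\<exists>q\<in>C \<times> D. \<exists>e>0. Metric_space.mball (X \<times> Y) (max_dist \<rho> \<sigma>) q e \<inter> P = {}"
proof (rule ccontr)
  interpret A: Metric_space X \<rho> by fact
  interpret B: Metric_space Y \<sigma> by fact
  interpret P: Metric_space "X \<times> Y" "max_dist \<rho> \<sigma>"
    by (rule Metric_space_max_dist) fact+
  note ball = mball_max_dist[OF assms(1,2)]
  assume "\<not> ?thesis"
  then have adh: "\<And>q e. \<lbrakk>q \<in> C \<times> D; 0 < e\<rbrakk> \<Longrightarrow> P.mball q e \<inter> P \<noteq> {}"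
    by blast
  \<comment> \<open>The hole found below belongs to scale \<open>R/2\<close> and has radius above
    \<open>c * (R/2)\<close>; hence the constant \<open>c/2\<close> at scale
    \<open>R\<close>.\<close>
  have fC: "\<exists>\<^sub>F R in at_right 0. \<not> (\<exists>z\<in>X. \<exists>r > (c/2) * R. A.mball z r \<subseteq> A.mball x R - C)"
    using A.not_lower_porous_at_frequently_no_hole[of C x "c/2"] x c by simp
  have fD: "\<forall>\<^sub>F R in at_right 0. \<not> (\<exists>z\<in>Y. \<exists>r > (c/2) * R. B.mball z r \<subseteq> B.mball y R - D)"
    using B.not_porous_at_eventually_no_hole[of D y "c/2"] y c by simp
  have f0: "\<forall>\<^sub>F R in at_right (0::real). 0 < R \<and> R < c"
    using c by (auto simp: eventually_at_right)
  have "\<exists>\<^sub>F R in at_right 0. 0 < R \<and> R < c \<and>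
      \<not> (\<exists>z\<in>X. \<exists>r > (c/2) * R. A.mball z r \<subseteq> A.mball x R - C) \<and>
      \<not> (\<exists>z\<in>Y. \<exists>r > (c/2) * R. B.mball z r \<subseteq> B.mball y R - D)"
    by (rule frequently_rev_mp[OF fC]) (use fD f0 in \<open>eventually_elim, blast\<close>)
  then obtain R where R: "0 < R" "R < c"
    and noC: "\<And>z r. \<lbrakk>z \<in> X; r > (c/2) * R\<rbrakk> \<Longrightarrow> \<not> A.mball z r \<subseteq> A.mball x R - C"
    and noD: "\<And>z r. \<lbrakk>z \<in> Y; r > (c/2) * R\<rbrakk> \<Longrightarrow> \<not> B.mball z r \<subseteq> B.mball y R - D"
    using frequently_ex by blast
  \<comment> \<open>\<open>(x, y)\<close> need not belong to \<open>P\<close>, so a nearby point of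
    \<open>P\<close> takes its place.\<close>
  obtain p where p: "p \<in> P" "p \<in> P.mball (x, y) (R/2)"
    using adh[of "(x, y)" "R/2"] x y R by (meson SigmaI disjoint_iff half_gt_zero)
  have "\<exists>q\<in>X \<times> Y. \<exists>r > c * (R/2). P.mball q r \<subseteq> P.mball p (R/2) - P"
    using c(2)[unfolded P.uniformly_holed_def, rule_format, OF p(1), of "R/2"] R by simp
  then obtain z w r where zw: "z \<in> X" "w \<in> Y" and r: "r > c * (R/2)"
    and hole: "P.mball (z, w) r \<subseteq> P.mball p (R/2) - P"
    by (elim bexE exE conjE SigmaE) (simp only:)
  have "r > 0" using r c R by (smt (verit) half_gt_zero mult_pos_pos)
  have "P.mball p (R/2) \<subseteq> P.mball (x, y) R"
    using p(2) by (intro P.mball_subset) (auto simp: P.commute)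
  then have "A.mball z r \<times> B.mball w r \<subseteq> A.mball x R \<times> B.mball y R"
    using hole by (auto simp: ball[symmetric])
  moreover have "z \<in> A.mball z r" "w \<in> B.mball w r" using zw \<open>r > 0\<close> by auto
  ultimately have "A.mball z r \<subseteq> A.mball x R" "B.mball w r \<subseteq> B.mball y R" by blast+
  moreover have "r > (c/2) * R" using r by simp
  \<comment> \<open>The projections of the hole are too large to miss \<open>C\<close> or
    \<open>D\<close>.\<close>
  ultimately have "\<exists>u. u \<in> A.mball z r \<and> u \<in> C" "\<exists>v. v \<in> B.mball w r \<and> v \<in> D"
    using noC[OF zw(1), of r] noD[OF zw(2), of r] by blast+
  then obtain u v where u: "u \<in> A.mball z r" "u \<in> C" and v: "v \<in> B.mball w r" "v \<in> D"
    by blast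
  then have "(u, v) \<in> P.mball (z, w) r" by (auto simp: ball)
  \<comment> \<open>\<open>(u, v)\<close> is adherent to \<open>P\<close>, yet interior to the
    hole.\<close>
  then obtain e where "e > 0" "P.mball (u, v) e \<subseteq> P.mball (z, w) r"
    using P.openin_mball unfolding P.openin_mtopology by meson
  moreover have "P.mball (u, v) e \<inter> P \<noteq> {}" using adh u v \<open>e > 0\<close> by blast
  ultimately show False using hole by blast
qed

section \<open>Suslin schemes and nested sequences\<close>

text \<open>The condition on \<open>f\<close> says that the branch extends \<open>s\<close>; the
  empty sequence gives the whole Suslin set.\<close>

definition suslin_piece :: "(nat list \<Rightarrow> 'a set) \<Rightarrow> nat list \<Rightarrow> 'a set" where
  "suslin_piece F s =
    (\<Union>f \<in> {f. map f [0..<length s] = s}. \<Inter>n. F (map f [0..<Suc n]))"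

lemma suslin_piece_Nil: "suslin_piece F [] = (\<Union>f. \<Inter>n. F (map f [0..<Suc n]))"
  by (simp add: suslin_piece_def)

text \<open>Sort the branches by their next value. As there are countably many values, non-smallness
  survives in a piece one level deeper.\<close>

lemma suslin_piece_split: "suslin_piece F s \<subseteq> (\<Union>i. suslin_piece F (s @ [i]))"
proof
  fix x assume "x \<in> suslin_piece F s"
  then obtain f where f: "map f [0..<length s] = s" "\<And>n. x \<in> F (map f [0..<Suc n])"
    by (auto simp: suslin_piece_def)
  then have "x \<in> suslin_piece F (s @ [f (length s)])"
    unfolding suslin_piece_def by (intro UN_I[of f]) simp_all
  then show "x \<in> (\<Union>i. suslin_piece F (s @ [i]))" by blast
qed

text \<open>The intersection starts with sequences of length 1, so it says nothing about
  \<open>F []\<close>.\<close>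

lemma suslin_piece_subset:
  assumes "s \<noteq> []"
  shows "suslin_piece F s \<subseteq> F s"
proof
  fix x assume "x \<in> suslin_piece F s"
  then obtain f where f: "map f [0..<length s] = s" "\<And>n. x \<in> F (map f [0..<Suc n])"
    by (auto simp: suslin_piece_def)
  obtain n where "length s = Suc n" using assms by (cases s) auto
  then show "x \<in> F s" using f(1) f(2)[of n] by simp
qed

text \<open>The one-term extensions glue to a single branch \<open>f\<close>, with
  \<open>s n\<close> its initial segment of length \<open>n\<close>.\<close>

lemma suslin_branch:
  fixes s :: "nat \<Rightarrow> nat list"
  assumes "s 0 = []" "\<And>n. \<exists>i. s (Suc n) = s n @ [i]" "\<And>n. x \<in> F (s (Suc n))"
  shows "x \<in> suslin_piece F []"
proof -
  obtain f where f: "\<And>n. s (Suc n) = s n @ [f n]" using assms(2) by metis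
  have "s n = map f [0..<n]" for n
    by (induction n) (auto simp: assms(1) f)
  then have "x \<in> F (map f [0..<Suc n])" for n
    using assms(3)[of n] by (simp only:)
  then show ?thesis
    unfolding suslin_piece_Nil by blast
qed

section \<open>Shrinking non-small sets\<close>

context pointwise_smallness
begin

lemma sigma_small_if_small: "small A \<Longrightarrow> sigma_small A"
  unfolding sigma_small_def by (intro exI[of _ "\<lambda>_. A"]) simp

text \<open>Two metrics act at once: \<open>d'\<close>, later the complete one, controls the size of
  \<open>C\<close>; the original one keeps its closure near \<open>x\<close>. A neighbourhood small
  in both meets \<open>K\<close> in a non-small set, which is then split along the Suslin
  scheme.\<close>

lemma non_sigma_small_shrink:
  assumes ker: "\<And>U. \<lbrakk>openin mtopology U; K \<inter> U \<noteq> {}\<rbrakk> \<Longrightarrow> \<not> sigma_small (K \<inter> U)"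
    and x: "x \<in> K" "x \<in> M" and K: "K \<subseteq> suslin_piece F s"
    and d': "Metric_space M d'" "Metric_space.mtopology M d' = mtopology"
    and pos: "0 < \<delta>" "0 < \<epsilon>"
  obtains C i where "C \<subseteq> K" "\<not> sigma_small C" "C \<subseteq> suslin_piece F (s @ [i])"
    "C \<subseteq> Metric_space.mcball M d' x \<epsilon>" "mtopology closure_of C \<subseteq> mcball x \<delta>"
proof -
  interpret D: Metric_space M d' by fact
  define U where "U = mball x \<delta> \<inter> D.mball x \<epsilon>"
  have "openin mtopology U"
    unfolding U_def using D.openin_mball[of x \<epsilon>] d'(2) by auto
  moreover have "x \<in> K \<inter> U" using x pos by (auto simp: U_def)
  ultimately have non: "\<not> sigma_small (K \<inter> U)" using ker by blast
  have "K \<inter> U \<subseteq> (\<Union>i. K \<inter> U \<inter> suslin_piece F (s @ [i]))"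
    using K suslin_piece_split[of F s] by blast
  then have "\<exists>i. \<not> sigma_small (K \<inter> U \<inter> suslin_piece F (s @ [i]))"
    using non sigma_small_subset sigma_small_UN[of "\<lambda>i. K \<inter> U \<inter> suslin_piece F (s @ [i])"]
    by blast
  then obtain i where i: "\<not> sigma_small (K \<inter> U \<inter> suslin_piece F (s @ [i]))" ..
  show ?thesis
  proof (rule that[OF _ i])
    have "K \<inter> U \<inter> suslin_piece F (s @ [i]) \<subseteq> mball x \<delta>" by (auto simp: U_def)
    then show "mtopology closure_of (K \<inter> U \<inter> suslin_piece F (s @ [i])) \<subseteq> mcball x \<delta>"
      using mball_subset_mcball by (intro closure_of_minimal closedin_mcball) blast
    show "K \<inter> U \<inter> suslin_piece F (s @ [i]) \<subseteq> D.mcball x \<epsilon>"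
      using D.mball_subset_mcball unfolding U_def by blast
  qed auto
qed

end

section \<open>Complete metrics and nested closures\<close>

lemma completely_metrizable_compatible:
  assumes "Metric_space X \<rho>" "completely_metrizable_space (Metric_space.mtopology X \<rho>)"
  obtains d where "Metric_space X d" "Metric_space.mcomplete X d"
    "Metric_space.mtopology X d = Metric_space.mtopology X \<rho>"
proof -
  obtain M d where d: "Metric_space M d" "Metric_space.mcomplete M d"
    "Metric_space.mtopology X \<rho> = Metric_space.mtopology M d"
    using assms(2) unfolding completely_metrizable_space_def by blast
  have "X = M"
    using d(3) Metric_space.topspace_mtopology[OF assms(1)] Metric_space.topspace_mtopology[OF d(1)]
    by simp
  then show ?thesis using that d by simp
qed

text \<open>Cantor's intersection theorem applied to the closures, which stay in the same closed
  balls. The radius bound starts at \<open>C (Suc 0)\<close>, so the initial set may be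
  large.\<close>

lemma (in Metric_space) mcomplete_shrinking_closures:
  fixes C :: "nat \<Rightarrow> 'a set"
  assumes "mcomplete" "\<And>n. C n \<subseteq> M" "\<And>n. C n \<noteq> {}" "\<And>n. C (Suc n) \<subseteq> C n"
    and small: "\<And>n. \<exists>a. C (Suc n) \<subseteq> mcball a (inverse (Suc n))"
  obtains x where "\<And>n. x \<in> mtopology closure_of C n"
proof -
  have "\<exists>n a. mtopology closure_of C n \<subseteq> mcball a \<epsilon>" if \<epsilon>: "\<epsilon> > 0" for \<epsilon>
  proof -
    obtain n where n: "inverse (Suc n) < \<epsilon>" using reals_Archimedean[OF \<epsilon>] by (rule exE)
    obtain a where "C (Suc n) \<subseteq> mcball a (inverse (Suc n))" using small[of n] by (elim exE)
    also have "\<dots> \<subseteq> mcball a \<epsilon>"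
      using n by (intro mcball_subset_concentric less_imp_le)
    finally have "C (Suc n) \<subseteq> mcball a \<epsilon>" .
    then have "mtopology closure_of C (Suc n) \<subseteq> mcball a \<epsilon>"
      by (rule closure_of_minimal[OF _ closedin_mcball])
    then show ?thesis by (intro exI)
  qed
  moreover have "decseq (\<lambda>n. mtopology closure_of C n)"
    by (rule decseq_SucI) (rule closure_of_mono[OF assms(4)])
  moreover have "mtopology closure_of C n \<noteq> {}" for n
  proof -
    have "C n \<subseteq> mtopology closure_of C n"
      by (rule closure_of_subset) (simp only: topspace_mtopology assms(2))
    then show ?thesis using assms(3)[of n] by (metis subset_empty)
  qed
  ultimately have "(\<Inter>n. mtopology closure_of C n) \<noteq> {}"
    by (intro mcomplete_nest[THEN iffD1, OF assms(1), rule_format] conjI allI impI closedin_closure_of)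
  then obtain x where "x \<in> (\<Inter>n. mtopology closure_of C n)"
    by (meson ex_in_conv)
  then show ?thesis by (intro that) (rule INT_D[OF _ UNIV_I])
qed

section \<open>A point of the product outside all covering sets\<close>

theorem theorem2:
  fixes X :: "'a set" and \<rho> :: "'a \<Rightarrow> 'a \<Rightarrow> real"
    and Y :: "'b set" and \<sigma> :: "'b \<Rightarrow> 'b \<Rightarrow> real"
    and A :: "'a set" and B :: "'b set"
  assumes "Metric_space X \<rho>" and "completely_metrizable_space (Metric_space.mtopology X \<rho>)"
    and "Metric_space Y \<sigma>" and "completely_metrizable_space (Metric_space.mtopology Y \<sigma>)"
    and "suslin_in (Metric_space.mtopology X \<rho>) A"
    and "suslin_in (Metric_space.mtopology Y \<sigma>) B"
    and "\<not> Metric_space.sigma_lower_porous X \<rho> A"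
    and "\<not> Metric_space.sigma_porous Y \<sigma> B"
  shows "\<not> Metric_space.sigma_lower_porous (X \<times> Y) (max_dist \<rho> \<sigma>) (A \<times> B)"
proof
  interpret MX: Metric_space X \<rho> by fact
  interpret MY: Metric_space Y \<sigma> by fact
  interpret P: Metric_space "X \<times> Y" "max_dist \<rho> \<sigma>"
    by (rule Metric_space_max_dist) fact+
  assume "P.sigma_lower_porous (A \<times> B)"
  then obtain P :: "nat \<Rightarrow> ('a \<times> 'b) set" and c :: "nat \<Rightarrow> real"
    where P: "\<And>n. 0 < c n" "\<And>n. P.uniformly_holed (c n) (P n)" "\<And>n. P n \<subseteq> X \<times> Y"
      "A \<times> B = (\<Union>n. P n)"
    by (rule P.sigma_lower_porous_uniformly_holed) blast
  obtain F where F: "\<And>s. closedin MX.mtopology (F s)" "A = suslin_piece F []"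
    using assms(5) unfolding suslin_in_def suslin_piece_Nil by blast
  obtain G where G: "\<And>s. closedin MY.mtopology (G s)" "B = suslin_piece G []"
    using assms(6) unfolding suslin_in_def suslin_piece_Nil by blast
  obtain d where d: "Metric_space X d" "Metric_space.mcomplete X d"
    "Metric_space.mtopology X d = MX.mtopology"
    using completely_metrizable_compatible[OF assms(1,2)] by blast
  obtain e where e: "Metric_space Y e" "Metric_space.mcomplete Y e"
    "Metric_space.mtopology Y e = MY.mtopology"
    using completely_metrizable_compatible[OF assms(3,4)] by blast
  interpret d: Metric_space X d by fact
  interpret e: Metric_space Y e by fact
  \<comment> \<open>A state: a non-small set in each factor, with the finite sequences locating it
    in the Suslin schemes.\<close>
  define good where "good = (\<lambda>(C, s, D, t).
    C \<subseteq> X \<and> C \<subseteq> suslin_piece F s \<and> \<not> MX.sigma_lower_porous C \<and>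
    D \<subseteq> Y \<and> D \<subseteq> suslin_piece G t \<and> \<not> MY.sigma_porous D)"
  \<comment> \<open>One round refines both sets and leaves \<open>P n\<close> behind. Closures are
    separated from \<open>P n\<close> because the limit point will only be known to lie in
    them.\<close>
  define step where "step n = (\<lambda>(C, s :: nat list, D, t :: nat list) (C', s', D', t').
    C' \<subseteq> C \<and> (\<exists>i. s' = s @ [i]) \<and> (\<exists>a. C' \<subseteq> d.mcball a (inverse (Suc n))) \<and>
    D' \<subseteq> D \<and> (\<exists>j. t' = t @ [j]) \<and> (\<exists>b. D' \<subseteq> e.mcball b (inverse (Suc n))) \<and>
    (MX.mtopology closure_of C') \<times> (MY.mtopology closure_of D') \<inter> P n = {})" for n
  have "A \<subseteq> X" "B \<subseteq> Y"
    using closedin_subset[OF F(1)] closedin_subset[OF G(1)]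
    unfolding F(2) G(2) suslin_piece_Nil by fastforce+
  then have init: "good (A, [], B, [])"
    using assms(7,8) by (simp add: good_def F(2)[symmetric] G(2)[symmetric])
  have ex_step: "\<exists>q. good q \<and> step n p q" if "good p" for n p
  proof -
    obtain C s D t where p: "p = (C, s, D, t)" by (cases p)
    have C: "C \<subseteq> X" "C \<subseteq> suslin_piece F s" "\<not> MX.sigma_lower_porous C"
      and D: "D \<subseteq> Y" "D \<subseteq> suslin_piece G t" "\<not> MY.sigma_porous D"
      using that by (auto simp: p good_def)
    obtain K where K: "K \<subseteq> C" "K \<noteq> {}"
      "\<And>U. \<lbrakk>openin MX.mtopology U; K \<inter> U \<noteq> {}\<rbrakk> \<Longrightarrow> \<not> MX.sigma_lower_porous (K \<inter> U)"
      by (rule MX.lower_porous.non_sigma_small_kernel[OF C(1,3)]) blast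
    obtain L where L: "L \<subseteq> D" "L \<noteq> {}"
      "\<And>U. \<lbrakk>openin MY.mtopology U; L \<inter> U \<noteq> {}\<rbrakk> \<Longrightarrow> \<not> MY.sigma_porous (L \<inter> U)"
      by (rule MY.porous.non_sigma_small_kernel[OF D(1,3)]) blast
    have KL: "K \<subseteq> X" "L \<subseteq> Y" using K(1) L(1) C(1) D(1) by blast+
    have "\<not> MX.sigma_lower_porous K"
      using K(3)[OF openin_topspace] K(2) KL(1) by (simp add: Int_absorb2)
    \<comment> \<open>Were \<open>K\<close> lower porous at each of its points, it would be
      \<sigma>-lower porous as a single set.\<close>
    then obtain x where x: "x \<in> K" "\<not> MX.lower_porous_at K x"
      using MX.lower_porous.sigma_small_if_small KL(1) unfolding MX.lower_porous_def by blast
    have "\<not> MY.sigma_porous L"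
      using L(3)[OF openin_topspace] L(2) KL(2) by (simp add: Int_absorb2)
    then obtain y where y: "y \<in> L" "\<not> MY.porous_at L y"
      using MY.porous.sigma_small_if_small KL(2) unfolding MY.porous_def by blast
    have "\<exists>q\<in>K \<times> L. \<exists>r>0. P.mball q r \<inter> P n = {}"
      using Times_not_uniformly_holed[OF assms(1,3) _ x _ y P(1,2,3)] x(1) y(1) KL by blast
    \<comment> \<open>This point need not be \<open>(x, y)\<close>. Here the kernels matter: all
      portions of \<open>K\<close> around \<open>u\<close> and of \<open>L\<close> around
      \<open>v\<close> are still non-small.\<close>
    then obtain u v r where uv: "u \<in> K" "v \<in> L" and r: "r > 0" "P.mball (u, v) r \<inter> P n = {}"
      by blast
    have pos: "0 < r / 2" "0 < inverse (real (Suc n))" using r by simp_all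
    have "u \<in> X" "v \<in> Y" using uv KL by blast+
    obtain C' i where C': "C' \<subseteq> K" "\<not> MX.sigma_lower_porous C'" "C' \<subseteq> suslin_piece F (s @ [i])"
      "C' \<subseteq> d.mcball u (inverse (Suc n))" "MX.mtopology closure_of C' \<subseteq> MX.mcball u (r / 2)"
      by (rule MX.lower_porous.non_sigma_small_shrink
        [OF K(3) uv(1) \<open>u \<in> X\<close> order_trans[OF K(1) C(2)] d(1,3) pos])
    obtain D' j where D': "D' \<subseteq> L" "\<not> MY.sigma_porous D'" "D' \<subseteq> suslin_piece G (t @ [j])"
      "D' \<subseteq> e.mcball v (inverse (Suc n))" "MY.mtopology closure_of D' \<subseteq> MY.mcball v (r / 2)"
      by (rule MY.porous.non_sigma_small_shrink
        [OF L(3) uv(2) \<open>v \<in> Y\<close> order_trans[OF L(1) D(2)] e(1,3) pos])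
    have "MX.mcball u (r / 2) \<subseteq> MX.mball u r" "MY.mcball v (r / 2) \<subseteq> MY.mball v r"
      using r by auto
    then have "(MX.mtopology closure_of C') \<times> (MY.mtopology closure_of D') \<subseteq> P.mball (u, v) r"
      unfolding mball_max_dist[OF assms(1,3)] using C'(5) D'(5) by blast
    then have "(MX.mtopology closure_of C') \<times> (MY.mtopology closure_of D') \<inter> P n = {}"
      using r(2) by blast
    then have "step n p (C', s @ [i], D', t @ [j])"
      unfolding step_def p using C'(1,4) D'(1,4) K(1) L(1) by auto
    moreover have "good (C', s @ [i], D', t @ [j])"
      unfolding good_def using C'(1-3) D'(1-3) KL by auto
    ultimately show ?thesis by blast
  qed
  have "\<exists>f. \<forall>n. (good (f n) \<and> (n = 0 \<longrightarrow> f n = (A, [], B, []))) \<and> step n (f n) (f (Suc n))"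
    by (rule dependent_nat_choice) (use init ex_step in auto)
  then obtain f where f: "\<And>n. good (f n)" "f 0 = (A, [], B, [])" "\<And>n. step n (f n) (f (Suc n))"
    by blast
  define C s D t where "C n = fst (f n)" and "s n = fst (snd (f n))"
    and "D n = fst (snd (snd (f n)))" and "t n = snd (snd (snd (f n)))" for n
  have f_eq: "f n = (C n, s n, D n, t n)" for n
    by (simp add: C_def s_def D_def t_def)
  have good: "C n \<subseteq> X" "C n \<subseteq> suslin_piece F (s n)" "\<not> MX.sigma_lower_porous (C n)"
    "D n \<subseteq> Y" "D n \<subseteq> suslin_piece G (t n)" "\<not> MY.sigma_porous (D n)" for n
    using f(1)[of n] by (auto simp: f_eq good_def)
  have step: "C (Suc n) \<subseteq> C n" "\<exists>i. s (Suc n) = s n @ [i]"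
    "\<exists>a. C (Suc n) \<subseteq> d.mcball a (inverse (Suc n))"
    "D (Suc n) \<subseteq> D n" "\<exists>j. t (Suc n) = t n @ [j]"
    "\<exists>b. D (Suc n) \<subseteq> e.mcball b (inverse (Suc n))"
    "(MX.mtopology closure_of C (Suc n)) \<times> (MY.mtopology closure_of D (Suc n)) \<inter> P n = {}" for n
    using f(3)[of n] unfolding f_eq step_def prod.case by blast+
  \<comment> \<open>The empty set is small, so the non-small sets \<open>C n\<close> and
    \<open>D n\<close> are nonempty.\<close>
  have "MX.lower_porous {}" "MY.porous {}"
    by (simp_all add: MX.lower_porous_def MY.porous_def)
  then have ne: "C n \<noteq> {}" "D n \<noteq> {}" for n
    using good(3,6)[of n] MX.lower_porous.sigma_small_if_small MY.porous.sigma_small_if_small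
    by metis+
  \<comment> \<open>Completeness is used for \<open>d\<close>; the closures are the same for
    \<open>\<rho>\<close>, as the topologies agree.\<close>
  obtain x where x: "\<And>n. x \<in> MX.mtopology closure_of C n"
    using d.mcomplete_shrinking_closures[OF d(2) good(1) ne(1) step(1,3)] unfolding d(3) by metis
  obtain y where y: "\<And>n. y \<in> MY.mtopology closure_of D n"
    using e.mcomplete_shrinking_closures[OF e(2) good(4) ne(2) step(4,6)] unfolding e(3) by metis
  have ne_list: "s (Suc n) \<noteq> []" "t (Suc n) \<noteq> []" for n
    using step(2,5)[of n] by auto
  \<comment> \<open>The sets of the scheme are closed, so they capture the limit point.\<close>
  have "MX.mtopology closure_of C (Suc n) \<subseteq> F (s (Suc n))" for n
    using order_trans[OF good(2) suslin_piece_subset[OF ne_list(1)]] F(1) by (rule closure_of_minimal)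
  then have "x \<in> A"
    unfolding F(2) using x by (intro suslin_branch[of s] step(2)) (auto simp: s_def f(2))
  moreover have "MY.mtopology closure_of D (Suc n) \<subseteq> G (t (Suc n))" for n
    using order_trans[OF good(5) suslin_piece_subset[OF ne_list(2)]] G(1) by (rule closure_of_minimal)
  then have "y \<in> B"
    unfolding G(2) using y by (intro suslin_branch[of t] step(5)) (auto simp: t_def f(2))
  ultimately obtain n where "(x, y) \<in> P n" using P(4) by blast
  then show False using step(7)[of n] x y by blast
qed

end
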